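(* Let $\mathcal{E}$ be a separable Hilbert space and let $B\in H^\infty_1(L(\mathcal{E}))$. Then for every $z\in\mathbb{D}$, $$I_{\mathcal{E}}-B(z)^*B(z)\ \geq\ \frac{1-|z|^2}{4}\bigl(I_{\mathcal{E}}-B(0)^*B(0)\bigr),$$ $$I_{\mathcal{E}}-B(z)B(z)^*\ \geq\ \frac{1-|z|^2}{4}\bigl(I_{\mathcal{E}}-B(0)B(0)^*\bigr).$$
   Context: Hilbert spaces are complex; $\mathbb{D}$ is the open unit disk. $L(\mathcal{E})$ is the algebra of bounded linear operators on $\mathcal{E}$, and $H^\infty_1(L(\mathcal{E}))$ is the set of analytic functions $B:\mathbb{D}\to L(\mathcal{E})$ with $\|B(z)\|\le 1$ for all $z\in\mathbb{D}$. For self-adjoint operators, $S\ge T$ means that $S-T$ is positive semidefinite. *)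

theory Defs
  imports "HOL-Analysis.Analysis"
begin

section \<open>Complex normed and Hilbert spaces\<close>

class scaleC =
  fixes scaleC :: "complex \<Rightarrow> 'a \<Rightarrow> 'a"  (infixr \<open>*\<^sub>C\<close> 75)

class complex_vector = scaleC + real_vector +
  assumes scaleC_add_right: "c *\<^sub>C (x + y) = c *\<^sub>C x + c *\<^sub>C y"
    and scaleC_add_left: "(c + d) *\<^sub>C x = c *\<^sub>C x + d *\<^sub>C x"
    and scaleC_scaleC: "c *\<^sub>C (d *\<^sub>C x) = (c * d) *\<^sub>C x"
    and scaleR_scaleC: "r *\<^sub>R x = complex_of_real r *\<^sub>C x"

class complex_normed_vector = complex_vector + real_normed_vector +
  assumes norm_scaleC: "norm (c *\<^sub>C x) = cmod c * norm x"

text \<open>The inner product is linear in its first argument.\<close>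

class complex_inner = complex_vector + real_normed_vector +
  fixes cinner :: "'a \<Rightarrow> 'a \<Rightarrow> complex"
  assumes cinner_commute: "cinner x y = cnj (cinner y x)"
    and cinner_add_left: "cinner (x + y) z = cinner x z + cinner y z"
    and cinner_scaleC_left: "cinner (c *\<^sub>C x) y = c * cinner x y"
    and cinner_ge_zero: "0 \<le> Re (cinner x x)"
    and cinner_eq_zero_iff: "cinner x x = 0 \<longleftrightarrow> x = 0"
    and norm_eq_sqrt_cinner: "norm x = sqrt (Re (cinner x x))"
begin

subclass complex_normed_vector
proof
  fix c :: complex and x :: 'a
  have "cinner (c *\<^sub>C x) (c *\<^sub>C x) = c * cnj c * cinner x x"
    using cinner_commute[of x "c *\<^sub>C x"] cinner_commute[of x x]
    by (simp add: cinner_scaleC_left)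
  then have "Re (cinner (c *\<^sub>C x) (c *\<^sub>C x)) = (cmod c)\<^sup>2 * Re (cinner x x)"
    by (simp add: complex_mult_cnj cmod_power2)
  then show "norm (c *\<^sub>C x) = cmod c * norm x"
    by (simp add: norm_eq_sqrt_cinner real_sqrt_mult)
qed

end

class complex_hilbert = complex_inner + complete_space

instantiation complex :: complex_hilbert
begin

definition "scaleC_complex c (x :: complex) = c * x"
definition "cinner_complex (x :: complex) y = x * cnj y"

instance
  by standard
    (auto simp: scaleC_complex_def cinner_complex_def algebra_simps scaleR_conv_of_real
      complex_mult_cnj cmod_def complex_eq_iff power2_eq_square add_nonneg_eq_0_iff)

end


section \<open>Bounded operators\<close>

lemma bounded_linear_scaleC: "bounded_linear (\<lambda>x::'a::complex_normed_vector. c *\<^sub>C x)"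
  by (rule bounded_linear_intro[where K = "cmod c"])
    (simp_all add: scaleC_add_right scaleR_scaleC scaleC_scaleC norm_scaleC mult.commute)

text \<open>
  The type \<open>'a \<Rightarrow>\<^sub>L 'b\<close> consists of the bounded \<^emph>\<open>real\<close>-linear maps, with the operator norm. It is a
  complex normed space under pointwise scalar multiplication.
\<close>

instantiation blinfun :: (real_normed_vector, complex_normed_vector) complex_normed_vector
begin

lift_definition scaleC_blinfun :: "complex \<Rightarrow> 'a \<Rightarrow>\<^sub>L 'b \<Rightarrow> 'a \<Rightarrow>\<^sub>L 'b"
  is "\<lambda>c f x. c *\<^sub>C f x"
  by (rule bounded_linear_compose[OF bounded_linear_scaleC])

instance
proof
  fix c d :: complex and r :: real and f g :: "'a \<Rightarrow>\<^sub>L 'b"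
  show "c *\<^sub>C (f + g) = c *\<^sub>C f + c *\<^sub>C g"
    by transfer (simp add: scaleC_add_right)
  show "(c + d) *\<^sub>C f = c *\<^sub>C f + d *\<^sub>C f"
    by transfer (simp add: scaleC_add_left)
  show "c *\<^sub>C (d *\<^sub>C f) = (c * d) *\<^sub>C f"
    by transfer (simp add: scaleC_scaleC)
  show "r *\<^sub>R f = complex_of_real r *\<^sub>C f"
    by transfer (simp add: scaleR_scaleC)
  have le: "norm (c *\<^sub>C f) \<le> cmod c * norm f" for c and f :: "'a \<Rightarrow>\<^sub>L 'b"
  proof (rule norm_blinfun_bound)
    show "norm ((c *\<^sub>C f) x) \<le> cmod c * norm f * norm x" for x
      using norm_blinfun[of f x]
      by (simp add: scaleC_blinfun.rep_eq norm_scaleC mult.assoc mult_left_mono)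
  qed simp
  show "norm (c *\<^sub>C f) = cmod c * norm f"
  proof (cases "c = 0")
    case True
    then show ?thesis using le[of 0 f] by simp
  next
    case False
    have "f = inverse c *\<^sub>C c *\<^sub>C f"
      using False scaleR_scaleC[where 'a = 'b, of 1]
      by transfer (simp add: scaleC_scaleC)
    then have "norm f \<le> cmod (inverse c) * norm (c *\<^sub>C f)"
      using le[of "inverse c" "c *\<^sub>C f"] by simp
    then have "cmod c * norm f \<le> norm (c *\<^sub>C f)"
      using False by (simp add: norm_inverse norm_divide field_simps)
    with le[of c f] show ?thesis by simp
  qed
qed

end

text \<open>The algebra \<open>L(E)\<close>: the complex-linear members of \<open>'a \<Rightarrow>\<^sub>L 'a\<close>.\<close>

definition bounded_operators :: "('a::complex_normed_vector \<Rightarrow>\<^sub>L 'a) set" where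
  "bounded_operators = {A. \<forall>c x. blinfun_apply A (c *\<^sub>C x) = c *\<^sub>C blinfun_apply A x}"

text \<open>
  Existence of the adjoint (for \<open>A\<close> in \<open>L(E)\<close>) is the Riesz representation theorem, so completeness
  of the space is needed for this description to be proper.
\<close>

definition cadjoint :: "('a::complex_hilbert \<Rightarrow>\<^sub>L 'a) \<Rightarrow> 'a \<Rightarrow>\<^sub>L 'a"  (\<open>_\<^sup>\<dagger>\<close> [1000] 999) where
  "A\<^sup>\<dagger> = (THE A'. A' \<in> bounded_operators \<and>
      (\<forall>x y. cinner (blinfun_apply A x) y = cinner x (blinfun_apply A' y)))"

definition self_adjoint :: "('a::complex_hilbert \<Rightarrow>\<^sub>L 'a) \<Rightarrow> bool" where
  "self_adjoint A \<longleftrightarrow> A \<in> bounded_operators \<and> A\<^sup>\<dagger> = A"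

definition positive_semidefinite :: "('a::complex_hilbert \<Rightarrow>\<^sub>L 'a) \<Rightarrow> bool" where
  "positive_semidefinite A \<longleftrightarrow>
     A \<in> bounded_operators \<and> (\<forall>x. cinner (blinfun_apply A x) x \<in> \<real>\<^sub>\<ge>\<^sub>0)"

definition op_ge :: "('a::complex_hilbert \<Rightarrow>\<^sub>L 'a) \<Rightarrow> ('a \<Rightarrow>\<^sub>L 'a) \<Rightarrow> bool"  (infix \<open>\<succeq>\<close> 50) where
  "S \<succeq> T \<longleftrightarrow> self_adjoint S \<and> self_adjoint T \<and> positive_semidefinite (S - T)"


section \<open>Operator-valued analytic functions\<close>

text \<open>
  \<open>holomorphic_on\<close> requires values in a normed field. For vector-valued functions, analyticity on
  an open set is complex differentiability (in norm) at every point.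
\<close>

definition complex_analytic_on ::
    "(complex \<Rightarrow> 'b::complex_normed_vector) \<Rightarrow> complex set \<Rightarrow> bool" where
  "complex_analytic_on f S \<longleftrightarrow> open S \<and>
     (\<forall>z\<in>S. \<exists>f'. ((\<lambda>w. inverse (w - z) *\<^sub>C (f w - f z)) \<longlongrightarrow> f') (at z))"

text \<open>
  The class \<open>H\<^sup>\<infinity>\<^sub>1(L(E))\<close>; functions on the disk are represented by total functions whose
  values outside the disk are irrelevant. Limits of difference quotients automatically lie in \<open>L(E)\<close>,
  which is norm-closed.
\<close>

definition Hinf1 :: "(complex \<Rightarrow> ('a::complex_hilbert \<Rightarrow>\<^sub>L 'a)) set" where
  "Hinf1 = {B. (\<forall>z\<in>ball 0 1. B z \<in> bounded_operators) \<and>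
     complex_analytic_on B (ball 0 1) \<and> (\<forall>z\<in>ball 0 1. norm (B z) \<le> 1)}"

end

theory Submission
  imports Defs "HOL-Complex_Analysis.Riemann_Mapping"
begin

text \<open>
  Both operator inequalities are statements about quadratic forms, and for a fixed vector \<open>x\<close> each of
  them reduces to a single scalar function. A holomorphic \<open>g\<close> on the disk with \<open>\<bar>g\<bar> \<le> 1\<close> satisfies, by
  Schwarz-Pick, \<open>\<bar>g z\<bar> \<le> (\<bar>g 0\<bar> + \<bar>z\<bar>) / (1 + \<bar>g 0\<bar> \<bar>z\<bar>)\<close>, and therefore
  \<open>1 - \<bar>g z\<bar>\<^sup>2 \<ge> (1 - \<bar>z\<bar>\<^sup>2) (1 - \<bar>g 0\<bar>\<^sup>2) / (1 + \<bar>g 0\<bar> \<bar>z\<bar>)\<^sup>2\<close>; the denominator is at most \<open>4\<close>,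
  which is where the constant comes from (\<open>Schwarz_Pick_defect\<close>).

  The matrix coefficients \<open>w \<mapsto> \<langle>B(w) u, v\<rangle>\<close> are holomorphic and bounded by \<open>\<parallel>u\<parallel> \<parallel>v\<parallel>\<close>. For the first
  inequality take \<open>u = x\<close> and \<open>v = B(z) x\<close>: the coefficient equals \<open>\<parallel>B(z) x\<parallel>\<^sup>2\<close> at \<open>z\<close>, so nothing is lost
  there, while at \<open>0\<close> it is at most \<open>\<parallel>B(0) x\<parallel> \<parallel>B(z) x\<parallel>\<close> by Cauchy-Schwarz. After division by
  \<open>\<parallel>x\<parallel> \<parallel>B(z) x\<parallel>\<close> the scalar estimate gives the required inequality of quadratic forms
  (\<open>Schwarz_Pick_norming\<close>). For the second inequality take \<open>u = B(z)\<^sup>\<dagger> x\<close> and \<open>v = x\<close>: the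
  coefficient \<open>\<langle>u, B(w)\<^sup>\<dagger> x\<rangle>\<close> is again holomorphic in \<open>w\<close>, and equals \<open>\<parallel>B(z)\<^sup>\<dagger> x\<parallel>\<^sup>2\<close> at \<open>z\<close>.

  To speak about adjoints at all one needs that they exist, which is the Riesz representation
  theorem (\<open>Riesz_real\<close>, \<open>adjoint_exists\<close>).
\<close>

section \<open>The complex inner product\<close>

lemma cinner_add_right: "cinner x (y + z) = cinner x y + cinner x (z::'a::complex_inner)"
  using cinner_commute[of x "y + z"] cinner_commute[of x y] cinner_commute[of x z]
  by (simp add: cinner_add_left)

lemma cinner_scaleC_right: "cinner x (c *\<^sub>C y) = cnj c * cinner x (y::'a::complex_inner)"
  using cinner_commute[of x "c *\<^sub>C y"] cinner_commute[of x y]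
  by (simp add: cinner_scaleC_left)

lemma cinner_scaleR_left: "cinner (r *\<^sub>R x) y = of_real r * cinner x (y::'a::complex_inner)"
  by (simp add: scaleR_scaleC cinner_scaleC_left)

lemma cinner_scaleR_right: "cinner x (r *\<^sub>R y) = of_real r * cinner x (y::'a::complex_inner)"
  by (simp add: scaleR_scaleC cinner_scaleC_right)

lemma cinner_minus_left: "cinner (- x) y = - cinner x (y::'a::complex_inner)"
  using cinner_scaleR_left[of "-1" x y] by simp

lemma cinner_minus_right: "cinner x (- y) = - cinner x (y::'a::complex_inner)"
  using cinner_scaleR_right[of x "-1" y] by simp

lemma cinner_diff_left: "cinner (x - y) z = cinner x z - cinner y (z::'a::complex_inner)"
  using cinner_add_left[of x "- y" z] by (simp add: cinner_minus_left)

lemma cinner_diff_right: "cinner x (y - z) = cinner x y - cinner x (z::'a::complex_inner)"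
  using cinner_add_right[of x y "- z"] by (simp add: cinner_minus_right)

lemmas cinner_algebra = cinner_add_left cinner_add_right cinner_diff_left cinner_diff_right
  cinner_scaleR_left cinner_scaleR_right

lemma scaleC_diff_right: "c *\<^sub>C (x - y) = c *\<^sub>C x - c *\<^sub>C (y::'a::complex_vector)"
  using scaleC_add_right[of c "x - y" y] by (simp add: algebra_simps)

lemma scaleR_scaleC_commute: "r *\<^sub>R (c *\<^sub>C x) = c *\<^sub>C (r *\<^sub>R (x::'a::complex_vector))"
  by (simp add: scaleR_scaleC scaleC_scaleC mult.commute)

lemma cinner_self: "cinner x x = of_real ((norm (x::'a::complex_inner))\<^sup>2)"
proof -
  have "Im (cinner x x) = 0"
    using cinner_commute[of x x] by (simp add: complex_eq_iff)
  then show ?thesis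
    by (simp add: complex_eq_iff norm_eq_sqrt_cinner cinner_ge_zero)
qed

lemma norm_add_squared:
  "(norm (x + y))\<^sup>2 = (norm x)\<^sup>2 + (norm y)\<^sup>2 + 2 * Re (cinner x (y::'a::complex_inner))"
proof -
  have "Re (cinner (x + y) (x + y)) = Re (cinner x x) + Re (cinner y y) + 2 * Re (cinner x y)"
    using cinner_commute[of y x] by (simp add: cinner_algebra)
  then show ?thesis
    by (simp add: cinner_self)
qed

lemma cinner_Cauchy_Schwarz: "cmod (cinner x y) \<le> norm x * norm (y::'a::complex_inner)"
proof (cases "y = 0")
  case True
  then show ?thesis
    using cinner_scaleR_right[of x 0 y] by simp
next
  case False
  define n where "n = (norm y)\<^sup>2"
  have n: "n > 0"
    using False by (simp add: n_def)
  define p where "p = cinner x y"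
  \<comment> \<open>The residual of the orthogonal projection of \<open>x\<close> onto the line through \<open>y\<close>.\<close>
  define c where "c = - (p / of_real n)"
  have "cinner x (c *\<^sub>C y) = - of_real ((cmod p)\<^sup>2 / n)"
    unfolding cinner_scaleC_right p_def[symmetric] c_def
    by (simp only: of_real_divide complex_norm_square) (simp add: mult.commute)
  then have "(norm (x + c *\<^sub>C y))\<^sup>2 = (norm x)\<^sup>2 + (norm (c *\<^sub>C y))\<^sup>2 - 2 * ((cmod p)\<^sup>2 / n)"
    by (simp only: norm_add_squared uminus_complex.sel Re_complex_of_real)
  moreover have "(norm (c *\<^sub>C y))\<^sup>2 = (cmod p)\<^sup>2 / n"
    using n by (simp add: norm_scaleC c_def norm_divide power_mult_distrib power_divide
        n_def[symmetric] power2_eq_square[of n])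
  ultimately have "(cmod p)\<^sup>2 / n \<le> (norm x)\<^sup>2"
    using zero_le_power2[of "norm (x + c *\<^sub>C y)"] by linarith
  then have "(cmod p)\<^sup>2 \<le> (norm x * norm y)\<^sup>2"
    using n by (simp add: field_simps power_mult_distrib n_def)
  then show ?thesis
    unfolding p_def by (rule power2_le_imp_le) simp
qed

lemma bounded_linear_cinner_left: "bounded_linear (\<lambda>x. cinner x (y::'a::complex_inner))"
  by (rule bounded_linear_intro[where K = "norm y"])
    (simp_all add: cinner_add_left cinner_scaleR_left scaleR_conv_of_real cinner_Cauchy_Schwarz)

text \<open>Conjugating both sides; this turns the adjunction identity of \<open>A\<close> into that of its adjoint.\<close>

lemma cinner_eq_flip:
  "cinner a b = cinner c d \<Longrightarrow> cinner b a = cinner d (c::'a::complex_inner)"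
  using cinner_commute[of b a] cinner_commute[of d c] by simp

lemma cinner_ext:
  assumes "\<And>x. cinner x y = cinner x (z::'a::complex_inner)"
  shows "y = z"
proof -
  have "cinner (y - z) (y - z) = 0"
    using assms[of "y - z"] by (simp add: cinner_diff_right)
  then show ?thesis
    by (simp add: cinner_eq_zero_iff)
qed

section \<open>Riesz representation and adjoints\<close>

text \<open>
  The representing vector is found as the minimiser of \<open>J x = \<parallel>x\<parallel>\<^sup>2 - 2 \<psi> x\<close>: if \<open>\<psi>\<close> is represented by
  \<open>y\<close>, then \<open>J x = \<parallel>x - y\<parallel>\<^sup>2 - \<parallel>y\<parallel>\<^sup>2\<close>. The parallelogram law makes minimising sequences Cauchy, so the
  minimum is attained, and the vanishing first variation there is the representation. The
  real-linear version suffices, since a complex-linear functional is determined by its real part.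
\<close>

lemma Riesz_real:
  fixes \<psi> :: "'a::complex_hilbert \<Rightarrow> real"
  assumes "bounded_linear \<psi>"
  shows "\<exists>y. \<forall>x. \<psi> x = Re (cinner x y)"
proof -
  interpret \<psi>: bounded_linear \<psi> by fact
  define J where "J x = (norm x)\<^sup>2 - 2 * \<psi> x" for x
  obtain K where K: "\<And>x. \<bar>\<psi> x\<bar> \<le> norm x * K"
    using \<psi>.bounded by auto
  have J_lower: "- K\<^sup>2 \<le> J x" for x
  proof -
    have "0 \<le> (norm x - K)\<^sup>2" by simp
    then show ?thesis
      using K[of x] by (simp add: J_def power2_diff)
  qed
  define m where "m = (INF x. J x)"
  have m_le: "m \<le> J x" for x
    unfolding m_def using J_lower by (intro cINF_lower bdd_belowI2) auto
  have "\<exists>x. J x < m + inverse (real (Suc n))" for n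
    using cInf_lessD[of "range J" "m + inverse (real (Suc n))"] by (auto simp: m_def)
  then obtain s where s: "\<And>n. J (s n) < m + inverse (real (Suc n))"
    by metis
  have parallelogram: "(norm (x - y))\<^sup>2 = 2 * J x + 2 * J y - 4 * J ((1/2) *\<^sub>R (x + y))" for x y
  proof -
    have "(norm (x - y))\<^sup>2 = (norm x)\<^sup>2 + (norm y)\<^sup>2 - 2 * Re (cinner x y)"
      using norm_add_squared[of x "- y"] by (simp add: cinner_minus_right)
    moreover have "4 * (norm ((1/2) *\<^sub>R (x + y)))\<^sup>2 = (norm x)\<^sup>2 + (norm y)\<^sup>2 + 2 * Re (cinner x y)"
      unfolding norm_add_squared[of x y, symmetric] by (simp add: power_divide)
    moreover have "2 * \<psi> ((1/2) *\<^sub>R (x + y)) = \<psi> x + \<psi> y"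
      by (simp add: \<psi>.scaleR \<psi>.add)
    ultimately show ?thesis
      unfolding J_def by algebra
  qed
  have "Cauchy s"
  proof (rule CauchyI)
    fix e :: real
    assume e: "0 < e"
    define \<delta> where "\<delta> = e\<^sup>2 / 4"
    have \<delta>: "4 * \<delta> = e\<^sup>2" "0 < \<delta>"
      using e by (simp_all add: \<delta>_def)
    then obtain N where N: "inverse (real (Suc N)) < \<delta>"
      using reals_Archimedean by blast
    have J_s: "J (s k) < m + \<delta>" if "k \<ge> N" for k
    proof -
      have "inverse (real (Suc k)) \<le> inverse (real (Suc N))"
        using that by (simp add: le_imp_inverse_le)
      then show ?thesis
        using s[of k] N by linarith
    qed
    have "norm (s i - s j) < e" if "i \<ge> N" "j \<ge> N" for i j
    proof -
      have "(norm (s i - s j))\<^sup>2 < e\<^sup>2"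
        using parallelogram[of "s i" "s j"] m_le[of "(1/2) *\<^sub>R (s i + s j)"] J_s[OF that(1)]
          J_s[OF that(2)] \<delta>(1) by linarith
      then show ?thesis
        using e by (simp add: power2_less_imp_less)
    qed
    then show "\<exists>N. \<forall>i\<ge>N. \<forall>j\<ge>N. norm (s i - s j) < e" by blast
  qed
  then obtain y where y: "s \<longlonglongrightarrow> y"
    using Cauchy_convergent_iff convergent_def by blast
  have "(\<lambda>n. J (s n)) \<longlonglongrightarrow> J y"
    unfolding J_def by (intro tendsto_intros y \<psi>.tendsto)
  moreover have "(\<lambda>n. m + inverse (real (Suc n))) \<longlonglongrightarrow> m + 0"
    by (intro tendsto_intros LIMSEQ_inverse_real_of_nat)
  ultimately have Jy: "J y \<le> m"
    using s by (intro LIMSEQ_le[of _ "J y" _ m]) (auto intro: less_imp_le)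
  have "\<psi> x = Re (cinner x y)" for x
  proof -
    define d where "d = Re (cinner x y) - \<psi> x"
    define n where "n = (norm x)\<^sup>2"
    \<comment> \<open>\<open>J\<close> on the line \<open>y + t x\<close> is a quadratic with slope \<open>2 d\<close> at its minimum \<open>t = 0\<close>; the \<open>+ 1\<close>
      avoids a division by zero.\<close>
    define t where "t = - d / (n + 1)"
    have n: "n \<ge> 0" by (simp add: n_def)
    have "J (y + t *\<^sub>R x) = J y + 2 * t * d + t\<^sup>2 * n"
      using cinner_commute[of y x]
      by (simp add: J_def norm_add_squared cinner_scaleR_right \<psi>.add \<psi>.scaleR d_def n_def
          power_mult_distrib algebra_simps)
    then have "0 \<le> 2 * t * d + t\<^sup>2 * n"
      using m_le[of "y + t *\<^sub>R x"] Jy by linarith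
    moreover have "2 * t * d + t\<^sup>2 * n = - (d\<^sup>2 * (n + 2) / (n + 1)\<^sup>2)"
      using n by (simp add: t_def divide_simps) algebra
    ultimately have "d\<^sup>2 * (n + 2) / (n + 1)\<^sup>2 \<le> 0" by linarith
    then have "d = 0"
      using n by (simp add: divide_le_0_iff mult_le_0_iff)
    then show ?thesis by (simp add: d_def)
  qed
  then show ?thesis by blast
qed

lemma bounded_operators_scaleC:
  "A \<in> bounded_operators \<Longrightarrow> blinfun_apply A (c *\<^sub>C x) = c *\<^sub>C blinfun_apply A x"
  by (simp add: bounded_operators_def)

text \<open>
  For each \<open>y\<close> the vector \<open>A' y\<close> represents the functional \<open>x \<mapsto> \<langle>A x, y\<rangle>\<close>. Linearity of \<open>A'\<close> follows from
  uniqueness of the representing vector, and boundedness from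
  \<open>\<parallel>A' y\<parallel>\<^sup>2 = \<langle>A (A' y), y\<rangle> \<le> \<parallel>A\<parallel> \<parallel>A' y\<parallel> \<parallel>y\<parallel>\<close>.
\<close>

lemma adjoint_exists:
  fixes A :: "'a::complex_hilbert \<Rightarrow>\<^sub>L 'a"
  assumes A: "A \<in> bounded_operators"
  shows "\<exists>A'\<in>bounded_operators. \<forall>x y. cinner (A x) y = cinner x (blinfun_apply A' y)"
proof -
  have "\<exists>v. \<forall>x. cinner (A x) y = cinner x v" for y
  proof -
    have "bounded_linear (\<lambda>x. Re (cinner (A x) y))"
      by (intro bounded_linear_compose[OF bounded_linear_Re]
          bounded_linear_compose[OF bounded_linear_cinner_left] blinfun.bounded_linear_right)
    then obtain v where v: "\<And>x. Re (cinner (A x) y) = Re (cinner x v)"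
      using Riesz_real by blast
    \<comment> \<open>The imaginary part of a complex-linear functional is its real part at \<open>- i x\<close>.\<close>
    have "Im (cinner (A x) y) = Im (cinner x v)" for x
      using v[of "(- \<i>) *\<^sub>C x"] by (simp add: bounded_operators_scaleC[OF A] cinner_scaleC_left)
    with v show ?thesis by (auto simp: complex_eq_iff)
  qed
  then obtain f where f: "\<And>x y. cinner (A x) y = cinner x (f y)"
    by metis
  have f_scaleC: "f (c *\<^sub>C y) = c *\<^sub>C f y" for c y
    by (rule cinner_ext) (simp add: f[symmetric] cinner_scaleC_right)
  have "bounded_linear f"
  proof (rule bounded_linear_intro[where K = "norm A"])
    show "f (x + y) = f x + f y" for x y
      by (rule cinner_ext) (simp add: f[symmetric] cinner_add_right)
    show "f (r *\<^sub>R y) = r *\<^sub>R f y" for r y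
      by (simp add: scaleR_scaleC f_scaleC)
    show "norm (f y) \<le> norm y * norm A" for y
    proof (cases "f y = 0")
      case False
      have "(norm (f y))\<^sup>2 = cmod (cinner (A (f y)) y)"
        by (simp add: f cinner_self norm_power)
      also have "\<dots> \<le> norm (A (f y)) * norm y"
        by (rule cinner_Cauchy_Schwarz)
      also have "\<dots> \<le> (norm A * norm (f y)) * norm y"
        by (intro mult_right_mono norm_blinfun) simp
      finally have "norm (f y) * norm (f y) \<le> norm (f y) * (norm y * norm A)"
        by (simp add: power2_eq_square mult_ac)
      then show ?thesis using False by simp
    qed simp
  qed
  then have "blinfun_apply (Blinfun f) = f"
    by (rule bounded_linear_Blinfun_apply)
  then show ?thesis
    using f f_scaleC by (intro bexI[of _ "Blinfun f"]) (auto simp: bounded_operators_def)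
qed

lemma cadjoint_eqI:
  assumes "A' \<in> bounded_operators" "\<And>x y. cinner (blinfun_apply A x) y = cinner x (blinfun_apply A' y)"
  shows "A\<^sup>\<dagger> = A'"
  unfolding cadjoint_def
proof (rule the_equality)
  fix C
  assume C: "C \<in> bounded_operators \<and>
    (\<forall>x y. cinner (blinfun_apply A x) y = cinner x (blinfun_apply C y))"
  show "C = A'"
  proof (rule blinfun_eqI)
    show "blinfun_apply C y = blinfun_apply A' y" for y
      by (rule cinner_ext) (simp add: assms(2)[symmetric] C)
  qed
qed (use assms in blast)

lemma
  assumes "A \<in> bounded_operators"
  shows cadjoint_bounded: "A\<^sup>\<dagger> \<in> bounded_operators"
    and cinner_cadjoint: "cinner (blinfun_apply A x) y = cinner x (blinfun_apply (A\<^sup>\<dagger>) y)"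
proof -
  obtain A' where A': "A' \<in> bounded_operators"
      "\<And>x y. cinner (blinfun_apply A x) y = cinner x (blinfun_apply A' y)"
    using adjoint_exists[OF assms] by blast
  have "A\<^sup>\<dagger> = A'" by (rule cadjoint_eqI) (fact A')+
  with A' show "A\<^sup>\<dagger> \<in> bounded_operators"
    and "cinner (blinfun_apply A x) y = cinner x (blinfun_apply (A\<^sup>\<dagger>) y)" by simp_all
qed

lemma cinner_cadjoint':
  assumes "A \<in> bounded_operators"
  shows "cinner (blinfun_apply (A\<^sup>\<dagger>) x) y = cinner x (blinfun_apply A y)"
  by (rule cinner_eq_flip) (simp add: cinner_cadjoint[OF assms])

lemma self_adjointI:
  assumes "S \<in> bounded_operators"
    and "\<And>x y. cinner (blinfun_apply S x) y = cinner x (blinfun_apply S y)"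
  shows "self_adjoint S"
  using assms cadjoint_eqI by (auto simp: self_adjoint_def)

lemma self_adjoint_defect:
  fixes C D :: "'a::complex_hilbert \<Rightarrow>\<^sub>L 'a"
  assumes "C \<in> bounded_operators" "D \<in> bounded_operators"
    and "\<And>x y. cinner (C x) y = cinner x (D y)"
  shows "self_adjoint (r *\<^sub>R (id_blinfun - (D o\<^sub>L C)))"
proof (rule self_adjointI)
  have "cinner (D x) y = cinner x (C y)" for x y
    by (rule cinner_eq_flip) (simp add: assms(3))
  with assms(3) show "cinner (blinfun_apply (r *\<^sub>R (id_blinfun - (D o\<^sub>L C))) x) y =
      cinner x (blinfun_apply (r *\<^sub>R (id_blinfun - (D o\<^sub>L C))) y)" for x y
    by (simp add: blinfun.scaleR_left blinfun.diff_left cinner_algebra)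
  show "r *\<^sub>R (id_blinfun - (D o\<^sub>L C)) \<in> bounded_operators"
    using assms(1,2)
    by (simp add: bounded_operators_def blinfun.scaleR_left blinfun.diff_left
        scaleC_diff_right[symmetric] scaleR_scaleC_commute)
qed

text \<open>
  The pair \<open>(C, D)\<close> stands for either \<open>(A, A\<^sup>\<dagger>)\<close> or \<open>(A\<^sup>\<dagger>, A)\<close>, so that the two defect operators \<open>I - A\<^sup>\<dagger> A\<close> and
  \<open>I - A A\<^sup>\<dagger>\<close> are treated at once: in both cases \<open>\<langle>(I - D C) x, x\<rangle> = \<parallel>x\<parallel>\<^sup>2 - \<parallel>C x\<parallel>\<^sup>2\<close>.
\<close>

lemma op_ge_defectI:
  fixes C D C\<^sub>0 D\<^sub>0 :: "'a::complex_hilbert \<Rightarrow>\<^sub>L 'a"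
  assumes C: "C \<in> bounded_operators" "D \<in> bounded_operators"
      "\<And>x y. cinner (C x) y = cinner x (D y)"
    and C\<^sub>0: "C\<^sub>0 \<in> bounded_operators" "D\<^sub>0 \<in> bounded_operators"
      "\<And>x y. cinner (C\<^sub>0 x) y = cinner x (D\<^sub>0 y)"
    and le: "\<And>x. k * ((norm x)\<^sup>2 - (norm (C\<^sub>0 x))\<^sup>2) \<le> (norm x)\<^sup>2 - (norm (C x))\<^sup>2"
  shows "id_blinfun - (D o\<^sub>L C) \<succeq> k *\<^sub>R (id_blinfun - (D\<^sub>0 o\<^sub>L C\<^sub>0))"
proof -
  let ?S = "id_blinfun - (D o\<^sub>L C)" and ?T = "k *\<^sub>R (id_blinfun - (D\<^sub>0 o\<^sub>L C\<^sub>0))"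
  have S: "self_adjoint ?S"
    using self_adjoint_defect[OF C, of 1] by simp
  have T: "self_adjoint ?T"
    using self_adjoint_defect[OF C\<^sub>0] by simp
  have "?S - ?T \<in> bounded_operators"
    using S T by (simp add: self_adjoint_def bounded_operators_def blinfun.diff_left
        scaleC_diff_right)
  moreover have "cinner (blinfun_apply (?S - ?T) x) x \<in> \<real>\<^sub>\<ge>\<^sub>0" for x
  proof -
    have "cinner (D (C x)) x = of_real ((norm (C x))\<^sup>2)"
      using C(3)[of x "C x"] cinner_eq_flip[of x "D (C x)" "C x" "C x"] by (simp add: cinner_self)
    moreover have "cinner (D\<^sub>0 (C\<^sub>0 x)) x = of_real ((norm (C\<^sub>0 x))\<^sup>2)"
      using C\<^sub>0(3)[of x "C\<^sub>0 x"] cinner_eq_flip[of x "D\<^sub>0 (C\<^sub>0 x)" "C\<^sub>0 x" "C\<^sub>0 x"]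
      by (simp add: cinner_self)
    ultimately have "cinner (blinfun_apply (?S - ?T) x) x =
        of_real (((norm x)\<^sup>2 - (norm (C x))\<^sup>2) - k * ((norm x)\<^sup>2 - (norm (C\<^sub>0 x))\<^sup>2))"
      by (simp add: blinfun.scaleR_left blinfun.diff_left cinner_algebra cinner_self)
    then show ?thesis
      using le[of x] by (simp del: of_real_diff of_real_mult)
  qed
  ultimately show ?thesis
    using S T by (simp add: op_ge_def positive_semidefinite_def)
qed

section \<open>The scalar Schwarz-Pick estimate\<close>

text \<open>
  The bound \<open>\<bar>g z\<bar> \<le> (a + r) / (1 + a r)\<close> with \<open>a = \<bar>g 0\<bar>\<close>, \<open>r = \<bar>z\<bar>\<close>, without division. Schwarz's lemma
  bounds the pseudo-hyperbolic distance of \<open>g z\<close> and \<open>g 0\<close> by \<open>r\<close>, and for given moduli that distance is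
  smallest when the two points have the same argument.
\<close>

lemma Schwarz_Pick_growth_strict:
  assumes g: "g holomorphic_on ball 0 1" "\<And>w. w \<in> ball 0 1 \<Longrightarrow> cmod (g w) < 1"
    and z: "z \<in> ball 0 1"
  shows "cmod (g z) * (1 + cmod (g 0) * cmod z) \<le> cmod (g 0) + cmod z"
proof -
  define a where "a = g 0"
  have a: "cmod a < 1" using g(2)[of 0] by (simp add: a_def)
  \<comment> \<open>Compose with the disk automorphism that takes \<open>g 0\<close> to \<open>0\<close>.\<close>
  define h where "h = Moebius_function 0 a \<circ> g"
  have "h holomorphic_on ball 0 1"
    unfolding h_def using g(2)
    by (intro holomorphic_on_compose_gen[OF g(1) Moebius_function_holomorphic[OF a]]) auto
  moreover have "h 0 = 0" by (simp add: h_def a_def Moebius_function_eq_zero)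
  moreover have "cmod (h w) < 1" if "cmod w < 1" for w
    unfolding h_def comp_def using that by (intro Moebius_function_norm_lt_1 a g(2)) simp
  ultimately have hz: "cmod (h z) \<le> cmod z"
    using Schwarz_Lemma(1)[of h z] z by auto
  have nz: "1 - cnj a * g z \<noteq> 0"
  proof
    assume "1 - cnj a * g z = 0"
    then have "cmod (cnj a * g z) = 1" by (metis eq_iff_diff_eq_0 norm_one)
    moreover have "cmod (cnj a * g z) < 1 * 1"
      unfolding norm_mult using a g(2)[OF z] by (intro mult_strict_mono') auto
    ultimately show False by simp
  qed
  have key: "(cmod (1 - cnj a * g z))\<^sup>2 - (cmod (g z - a))\<^sup>2 =
      (1 - (cmod a)\<^sup>2) * (1 - (cmod (g z))\<^sup>2)"
    unfolding cmod_power2 by (simp add: power2_eq_square algebra_simps)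
  define r b where "r = cmod z" and "b = cmod (g z)"
  have r: "0 \<le> r" "r < 1" using z by (auto simp: r_def)
  have b: "0 \<le> b" "b < 1" using g(2)[OF z] by (auto simp: b_def)
  have "cmod (g z - a) \<le> r * cmod (1 - cnj a * g z)"
    using hz nz by (simp add: h_def Moebius_function_simple norm_divide r_def field_simps)
  then have "(cmod (g z - a))\<^sup>2 \<le> r\<^sup>2 * (cmod (1 - cnj a * g z))\<^sup>2"
    by (metis norm_ge_zero power_mono power_mult_distrib)
  then have 1: "(1 - r\<^sup>2) * (cmod (1 - cnj a * g z))\<^sup>2 \<le> (1 - (cmod a)\<^sup>2) * (1 - b\<^sup>2)"
    using key by (simp add: b_def algebra_simps)
  \<comment> \<open>By \<open>key\<close> the distance depends on the arguments only through this denominator.\<close>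
  have "1 - cmod a * b \<le> cmod (1 - cnj a * g z)"
    using norm_triangle_ineq2[of 1 "cnj a * g z"] by (simp add: norm_mult b_def)
  moreover have "0 \<le> 1 - cmod a * b"
    using a b by (simp add: mult_le_one)
  ultimately have "(1 - r\<^sup>2) * (1 - cmod a * b)\<^sup>2 \<le> (1 - r\<^sup>2) * (cmod (1 - cnj a * g z))\<^sup>2"
    using r by (intro mult_left_mono power_mono) (auto simp: power_le_one)
  with 1 have 2: "(b - cmod a)\<^sup>2 \<le> (r * (1 - cmod a * b))\<^sup>2"
    by (simp add: power2_eq_square algebra_simps)
  have "b - cmod a \<le> r * (1 - cmod a * b)"
    using 2 r \<open>0 \<le> 1 - cmod a * b\<close> by (intro power2_le_imp_le[OF 2]) auto
  then show ?thesis
    by (simp add: r_def b_def a_def algebra_simps)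
qed

text \<open>
  Scaling \<open>g\<close> by \<open>t < 1\<close> and letting \<open>t\<close> tend to \<open>1\<close> covers the functions that attain modulus \<open>1\<close>.
\<close>

lemma Schwarz_Pick_growth:
  assumes g: "g holomorphic_on ball 0 1" "\<And>w. w \<in> ball 0 1 \<Longrightarrow> cmod (g w) \<le> 1"
    and z: "z \<in> ball 0 1"
  shows "cmod (g z) * (1 + cmod (g 0) * cmod z) \<le> cmod (g 0) + cmod z"
proof -
  have strict: "t * cmod (g z) * (1 + t * cmod (g 0) * cmod z) \<le> t * cmod (g 0) + cmod z"
    if t: "0 < t" "t < 1" for t :: real
  proof -
    have "cmod (of_real t * g w) < 1" if "w \<in> ball 0 1" for w
    proof -
      have "t * cmod (g w) \<le> t * 1"
        using g(2)[OF that] t by (intro mult_left_mono) auto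
      with t have "t * cmod (g w) < 1" by linarith
      with t show ?thesis by (simp add: norm_mult)
    qed
    then show ?thesis
      using Schwarz_Pick_growth_strict[of "\<lambda>w. of_real t * g w" z] g(1) z t
      by (simp add: norm_mult holomorphic_intros)
  qed
  have "((\<lambda>t. t * cmod (g z) * (1 + t * cmod (g 0) * cmod z)) \<longlongrightarrow>
      1 * cmod (g z) * (1 + 1 * cmod (g 0) * cmod z)) (at_left 1)"
    by (intro tendsto_intros)
  moreover have "((\<lambda>t. t * cmod (g 0) + cmod z) \<longlongrightarrow> 1 * cmod (g 0) + cmod z) (at_left 1)"
    by (intro tendsto_intros)
  moreover have "\<forall>\<^sub>F t in at_left 1. t * cmod (g z) * (1 + t * cmod (g 0) * cmod z)
      \<le> t * cmod (g 0) + cmod z"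
    using eventually_at_left_real[of 0 "1::real"] by (auto elim!: eventually_mono intro: strict)
  ultimately have "1 * cmod (g z) * (1 + 1 * cmod (g 0) * cmod z) \<le> 1 * cmod (g 0) + cmod z"
    by (intro tendsto_le[OF trivial_limit_at_left_real]) auto
  then show ?thesis by simp
qed

text \<open>
  With \<open>a = \<bar>g 0\<bar>\<close> and \<open>r = \<bar>z\<bar>\<close> this rests on the identity
  \<open>(1 + a r)\<^sup>2 - (a + r)\<^sup>2 = (1 - a\<^sup>2) (1 - r\<^sup>2)\<close> and on \<open>1 + a r \<le> 2\<close>.
\<close>

lemma Schwarz_Pick_defect:
  assumes g: "g holomorphic_on ball 0 1" "\<And>w. w \<in> ball 0 1 \<Longrightarrow> cmod (g w) \<le> 1"
    and z: "z \<in> ball 0 1"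
  shows "(1 - (cmod z)\<^sup>2) / 4 * (1 - (cmod (g 0))\<^sup>2) \<le> 1 - (cmod (g z))\<^sup>2"
proof -
  define a b r where "a = cmod (g 0)" and "b = cmod (g z)" and "r = cmod z"
  have a: "0 \<le> a" "a \<le> 1" and b: "0 \<le> b" "b \<le> 1" and r: "0 \<le> r" "r < 1"
    using g(2)[of 0] g(2)[OF z] z by (auto simp: a_def b_def r_def)
  let ?q = "1 + a * r"
  have q: "1 \<le> ?q" "?q \<le> 2"
    using a r by (auto intro: mult_le_one)
  have "b * ?q \<le> a + r"
    using Schwarz_Pick_growth[OF g z] by (simp add: a_def b_def r_def)
  then have "(b * ?q)\<^sup>2 \<le> (a + r)\<^sup>2"
    using a b r by (intro power_mono mult_nonneg_nonneg) auto
  then have "(1 - r\<^sup>2) * (1 - a\<^sup>2) \<le> ?q\<^sup>2 * (1 - b\<^sup>2)"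
    by (simp add: power2_eq_square algebra_simps)
  also have "\<dots> \<le> 2\<^sup>2 * (1 - b\<^sup>2)"
    using q b by (intro mult_right_mono power_mono) (auto simp: power_le_one)
  finally show ?thesis
    by (simp add: a_def b_def r_def)
qed

text \<open>
  The form in which the scalar estimate is applied to a vector \<open>f z\<close> of norm \<open>b\<close> tested against itself:
  \<open>M\<close> bounds the norm of \<open>f\<close> on the disk, \<open>a\<close> is the norm of \<open>f 0\<close>, and \<open>g\<close> is the pairing of \<open>f\<close> with
  \<open>f z\<close>, or its conjugate. One divides \<open>g\<close> by its bound \<open>M b\<close>; if \<open>b = 0\<close> the claim is trivial.
\<close>

lemma Schwarz_Pick_norming:
  assumes g: "g holomorphic_on ball 0 1" "\<And>w. w \<in> ball 0 1 \<Longrightarrow> cmod (g w) \<le> M * b"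
    and z: "z \<in> ball 0 1"
    and gz: "cmod (g z) = b\<^sup>2" and g0: "cmod (g 0) \<le> a * b"
    and b: "0 \<le> b" "b \<le> M"
  shows "(1 - (cmod z)\<^sup>2) / 4 * (M\<^sup>2 - a\<^sup>2) \<le> M\<^sup>2 - b\<^sup>2"
proof (cases "b = 0")
  case True
  have k: "0 \<le> 1 - (cmod z)\<^sup>2" using z by (simp add: power_le_one)
  have "(1 - (cmod z)\<^sup>2) / 4 * (M\<^sup>2 - a\<^sup>2) \<le> (1 - (cmod z)\<^sup>2) / 4 * M\<^sup>2"
    using k by (intro mult_left_mono) auto
  also have "\<dots> \<le> 1 * M\<^sup>2"
  proof (rule mult_right_mono)
    show "(1 - (cmod z)\<^sup>2) / 4 \<le> 1"
      using zero_le_power2[of "cmod z"] by (simp add: field_simps del: zero_le_power2)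
  qed simp
  finally show ?thesis using True by simp
next
  case False
  then have pos: "0 < b" "0 < M" using b by auto
  let ?k = "(1 - (cmod z)\<^sup>2) / 4"
  have k: "0 \<le> ?k" using z by (simp add: power_le_one)
  have hol: "(\<lambda>w. g w / of_real (M * b)) holomorphic_on ball 0 1"
    using pos by (intro holomorphic_intros g) auto
  have "?k * (1 - (cmod (g 0) / (M * b))\<^sup>2) \<le> 1 - (b\<^sup>2 / (M * b))\<^sup>2"
    using Schwarz_Pick_defect[OF hol _ z] g(2) pos gz by (simp add: norm_divide norm_mult)
  moreover have "cmod (g 0) / (M * b) \<le> a / M"
    using g0 pos by (simp add: field_simps)
  then have "(cmod (g 0) / (M * b))\<^sup>2 \<le> (a / M)\<^sup>2"
    using pos by (intro power_mono) auto
  then have "?k * (1 - (a / M)\<^sup>2) \<le> ?k * (1 - (cmod (g 0) / (M * b))\<^sup>2)"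
    using k by (intro mult_left_mono) auto
  moreover have "b\<^sup>2 / (M * b) = b / M"
    using pos by (simp add: power2_eq_square)
  ultimately have "?k * (1 - (a / M)\<^sup>2) \<le> 1 - (b / M)\<^sup>2"
    by simp
  then have "M\<^sup>2 * (?k * (1 - (a / M)\<^sup>2)) \<le> M\<^sup>2 * (1 - (b / M)\<^sup>2)"
    by (intro mult_left_mono) auto
  moreover have "M\<^sup>2 * (1 - (c / M)\<^sup>2) = M\<^sup>2 - c\<^sup>2" for c
    using pos by (simp add: field_simps)
  ultimately show ?thesis
    by (metis mult.left_commute)
qed

section \<open>Contractive operator-valued functions\<close>

lemma holomorphic_matrix_coefficient:
  fixes B :: "complex \<Rightarrow> ('a::complex_hilbert \<Rightarrow>\<^sub>L 'a)"
  assumes "complex_analytic_on B S"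
  shows "(\<lambda>w. cinner (B w u) v) holomorphic_on S"
proof -
  have S: "open S" using assms by (simp add: complex_analytic_on_def)
  have bl: "bounded_linear (\<lambda>A :: 'a \<Rightarrow>\<^sub>L 'a. cinner (blinfun_apply A u) v)"
    by (intro bounded_linear_compose[OF bounded_linear_cinner_left] blinfun.bounded_linear_left)
  have "\<exists>D. ((\<lambda>w. cinner (B w u) v) has_field_derivative D) (at z)" if "z \<in> S" for z
  proof -
    obtain B' where "((\<lambda>w. inverse (w - z) *\<^sub>C (B w - B z)) \<longlongrightarrow> B') (at z)"
      using assms \<open>z \<in> S\<close> by (auto simp: complex_analytic_on_def)
    from bounded_linear.tendsto[OF bl this]
    have "((\<lambda>w. (cinner (B w u) v - cinner (B z u) v) / (w - z)) \<longlongrightarrow> cinner (B' u) v) (at z)"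
      by (simp add: scaleC_blinfun.rep_eq cinner_scaleC_left blinfun.diff_left cinner_diff_left
          divide_inverse mult.commute)
    then show ?thesis by (auto simp: has_field_derivative_iff)
  qed
  then show ?thesis
    using S by (auto simp: holomorphic_on_open)
qed

theorem lemma2p3:
  fixes B :: "complex \<Rightarrow> ('a::complex_hilbert \<Rightarrow>\<^sub>L 'a)" and z :: complex
  assumes "separable_space (euclidean :: 'a topology)"
    and "B \<in> Hinf1"
    and "z \<in> ball 0 1"
  shows "(id_blinfun - ((B z)\<^sup>\<dagger> o\<^sub>L B z)) \<succeq>
           ((1 - (cmod z)\<^sup>2) / 4) *\<^sub>R (id_blinfun - ((B 0)\<^sup>\<dagger> o\<^sub>L B 0))
       \<and> (id_blinfun - (B z o\<^sub>L (B z)\<^sup>\<dagger>)) \<succeq>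
           ((1 - (cmod z)\<^sup>2) / 4) *\<^sub>R (id_blinfun - (B 0 o\<^sub>L (B 0)\<^sup>\<dagger>))"
proof -
  have bd: "B w \<in> bounded_operators" and contr: "norm (B w) \<le> 1" if "w \<in> ball 0 1" for w
    using assms(2) that by (auto simp: Hinf1_def)
  have hol: "(\<lambda>w. cinner (B w u) v) holomorphic_on ball 0 1" for u v
    using assms(2) by (intro holomorphic_matrix_coefficient) (auto simp: Hinf1_def)
  have zero: "(0::complex) \<in> ball 0 1" by simp
  have Bx: "norm (B w x) \<le> norm x" if "w \<in> ball 0 1" for w x
    using norm_blinfun[of "B w" x] mult_right_mono[OF contr[OF that], of "norm x"] by simp
  have bound: "cmod (cinner (B w u) v) \<le> norm u * norm v" if "w \<in> ball 0 1" for w u v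
    using cinner_Cauchy_Schwarz[of "B w u" v] mult_right_mono[OF Bx[OF that, of u], of "norm v"]
    by simp
  let ?k = "(1 - (cmod z)\<^sup>2) / 4"
  have left: "?k * ((norm x)\<^sup>2 - (norm (B 0 x))\<^sup>2) \<le> (norm x)\<^sup>2 - (norm (B z x))\<^sup>2" for x
  proof (rule Schwarz_Pick_norming[OF hol _ assms(3)])
    show "cmod (cinner (B z x) (B z x)) = (norm (B z x))\<^sup>2"
      by (simp add: cinner_self norm_power)
  qed (use assms(3) in \<open>auto intro: bound Bx cinner_Cauchy_Schwarz\<close>)
  have right: "?k * ((norm x)\<^sup>2 - (norm (((B 0)\<^sup>\<dagger>) x))\<^sup>2) \<le> (norm x)\<^sup>2 - (norm (((B z)\<^sup>\<dagger>) x))\<^sup>2" for x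
  proof -
    let ?u = "((B z)\<^sup>\<dagger>) x"
    have gz: "cmod (cinner (B z ?u) x) = (norm ?u)\<^sup>2"
      by (simp add: cinner_cadjoint[OF bd[OF assms(3)]] cinner_self norm_power)
    \<comment> \<open>The adjoint of a contraction is a contraction.\<close>
    have le: "norm ?u \<le> norm x"
    proof (cases "?u = 0")
      case False
      have "norm ?u * norm ?u \<le> norm ?u * norm x"
        using bound[OF assms(3), of ?u x] gz by (simp add: power2_eq_square)
      with False show ?thesis by simp
    qed simp
    show ?thesis
    proof (rule Schwarz_Pick_norming[OF hol _ assms(3) gz])
      show "cmod (cinner (B 0 ?u) x) \<le> norm (((B 0)\<^sup>\<dagger>) x) * norm ?u"
        using cinner_Cauchy_Schwarz[of ?u "((B 0)\<^sup>\<dagger>) x"]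
        by (simp add: cinner_cadjoint[OF bd[OF zero]] mult.commute)
      show "cmod (cinner (B w ?u) x) \<le> norm x * norm ?u" if "w \<in> ball 0 1" for w
        using bound[OF that, of ?u x] by (simp add: mult.commute)
    qed (use le in auto)
  qed
  show ?thesis
    using left right assms(3) zero
    by (intro conjI op_ge_defectI bd cadjoint_bounded cinner_cadjoint cinner_cadjoint') auto
qed

end
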